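(* Let $d\ge 1$, $k\ge 1$ be integers and let $c>0$, $b_1,\dots,b_k>0$ pairwise distinct, and $a_1,\dots,a_k\in\mathbb{R}\setminus\{0\}$ be constants. Let $A_j$ be the constant matrices defined in the context. Then the operator $L=\partial_t+\sum_{j=1}^dA_j\partial_{x_j}$ is constantly hyperbolic, with $m=3$, eigenvalues $\lambda_1(\xi)=-c|\xi|$, $\lambda_2(\xi)=0$, $\lambda_3(\xi)=c|\xi|$, and multiplicities $l_1=1$, $l_2=kd+d-1$, $l_3=1$.
   Context: Set $n=kd+d+1$. Vectors are written in block form $(u,v,w_1,\dots,w_k)$ with $u$ scalar and $v,w_1,\dots,w_k$ having $d$ components. The $n\times n$ real matrices $A_1,\dots,A_d$ are defined by: for $\xi\in\mathbb{R}^d$, $A(\xi)=\sum_{j=1}^d\xi_jA_j$ satisfies $$A(\xi)(u,v,w_1,\dots,w_k)=(\xi\cdot v,\;c^2\xi u,\;-a_1\xi u,\dots,-a_k\xi u).$$ Definition (constantly hyperbolic): an operator $L=\partial_t+\sum_{j=1}^dA_j\partial_{x_j}$ with real $N\times N$ matrices $A_j$ is called constantly hyperbolic if there exist an integer $m\ge1$, natural numbers $l_1,\dots,l_m$ and real-valued functions $\lambda_1,\dots,\lambda_m$, analytic away from the origin, such that for any $\xi\in\mathbb{S}^{d-1}$ $$\det\Big(\lambda I_N+\sum_{j=1}^d\xi_jA_j\Big)=\prod_{i=1}^m(\lambda+\lambda_i(\xi))^{l_i},\qquad l_1+\dots+l_m=N,$$ where all the eigenvalues $\lambda_i(\xi)$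 of $A(\xi)=\sum_{j=1}^d\xi_jA_j$ are real, semi-simple (algebraic multiplicity equals geometric multiplicity) and satisfy $\lambda_1(\xi)<\dots<\lambda_m(\xi)$. *)

theory Defs
  imports "HOL-Analysis.Analysis" "HOL-Computational_Algebra.Polynomial"
begin

section \<open>Real-analytic functions of several variables\<close>

text \<open>
  The library only has analyticity for functions of one complex variable. Here \<open>\<alpha>\<close> ranges over
  the multi-indices \<open>'d \<Rightarrow> nat\<close>, and \<open>has_sum\<close> is unconditional (hence absolute) convergence.
\<close>

definition real_analytic_at :: "(real ^ 'd \<Rightarrow> real) \<Rightarrow> real ^ 'd \<Rightarrow> bool" where
  "real_analytic_at f x \<longleftrightarrow>
     (\<exists>(C :: ('d \<Rightarrow> nat) \<Rightarrow> real) r. r > 0 \<and>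
        (\<forall>y \<in> ball x r. ((\<lambda>\<alpha>. C \<alpha> * (\<Prod>j\<in>UNIV. (y $ j - x $ j) ^ \<alpha> j)) has_sum f y) UNIV))"

definition real_analytic_on :: "(real ^ 'd \<Rightarrow> real) \<Rightarrow> (real ^ 'd) set \<Rightarrow> bool" where
  "real_analytic_on f S \<longleftrightarrow> (\<forall>x\<in>S. real_analytic_at f x)"


section \<open>Eigenvalues and multiplicities\<close>

definition is_eigenvalue :: "'a::field ^ 'n ^ 'n \<Rightarrow> 'a \<Rightarrow> bool" where
  "is_eigenvalue M \<mu> \<longleftrightarrow> (\<exists>x. x \<noteq> 0 \<and> M *v x = \<mu> *s x)"

definition charpoly :: "real ^ 'n ^ 'n \<Rightarrow> real poly" where
  "charpoly M = det (\<chi> i j. (if i = j then [:0, 1:] else 0) - [:M $ i $ j:])"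

definition algebraic_multiplicity :: "real ^ 'n ^ 'n \<Rightarrow> real \<Rightarrow> nat" where
  "algebraic_multiplicity M \<mu> = order \<mu> (charpoly M)"

definition geometric_multiplicity :: "real ^ 'n ^ 'n \<Rightarrow> real \<Rightarrow> nat" where
  "geometric_multiplicity M \<mu> = dim {x. M *v x = \<mu> *s x}"

definition semisimple_eigenvalue :: "real ^ 'n ^ 'n \<Rightarrow> real \<Rightarrow> bool" where
  "semisimple_eigenvalue M \<mu> \<longleftrightarrow>
     is_eigenvalue M \<mu> \<and> algebraic_multiplicity M \<mu> = geometric_multiplicity M \<mu>"


section \<open>Constantly hyperbolic operators\<close>

text \<open>
  The operator \<open>\<partial>\<^sub>t + (\<Sum>j. A\<^sub>j \<partial>\<^sub>j)\<close> is represented by its family of coefficient matrices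
  \<open>A :: 'd \<Rightarrow> real ^ 'n ^ 'n\<close>.
\<close>

definition symbol :: "('d::finite \<Rightarrow> real ^ 'n ^ 'n) \<Rightarrow> real ^ 'd \<Rightarrow> real ^ 'n ^ 'n" where
  "symbol A \<xi> = (\<Sum>j\<in>UNIV. \<xi> $ j *\<^sub>R A j)"

text \<open>
  The families \<open>l\<close> and \<open>lam\<close> are only used at the indices \<open>1, \<dots>, m\<close>. The clause on the
  complexified matrix says that all (a priori complex) eigenvalues of the symbol are real and are
  exactly the \<open>lam i \<xi>\<close>; in particular it excludes \<open>l i = 0\<close>.
\<close>

definition constantly_hyperbolic_with ::
  "('d::finite \<Rightarrow> real ^ 'n ^ 'n) \<Rightarrow> nat \<Rightarrow> (nat \<Rightarrow> nat) \<Rightarrow> (nat \<Rightarrow> real ^ 'd \<Rightarrow> real) \<Rightarrow> bool" where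
  "constantly_hyperbolic_with A m l lam \<longleftrightarrow>
     m \<ge> 1 \<and>
     (\<forall>i\<in>{1..m}. real_analytic_on (lam i) (- {0})) \<and>
     (\<Sum>i=1..m. l i) = CARD('n) \<and>
     (\<forall>\<xi>\<in>sphere 0 1.
        (\<forall>x::real. det (mat x + symbol A \<xi>) = (\<Prod>i=1..m. (x + lam i \<xi>) ^ l i)) \<and>
        {z. is_eigenvalue (map_matrix complex_of_real (symbol A \<xi>)) z} =
          (\<lambda>i. complex_of_real (lam i \<xi>)) ` {1..m} \<and>
        (\<forall>i\<in>{1..m}. semisimple_eigenvalue (symbol A \<xi>) (lam i \<xi>)) \<and>
        (\<forall>i\<in>{1..m}. \<forall>j\<in>{1..m}. i < j \<longrightarrow> lam i \<xi> < lam j \<xi>))"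

definition constantly_hyperbolic :: "('d::finite \<Rightarrow> real ^ 'n ^ 'n) \<Rightarrow> bool" where
  "constantly_hyperbolic A \<longleftrightarrow> (\<exists>m l lam. constantly_hyperbolic_with A m l lam)"


section \<open>The block matrices\<close>

text \<open>
  Vectors \<open>(u, v, w\<^sub>1, \<dots>, w\<^sub>k)\<close> are indexed by a sum type with \<open>1 + d + k d\<close> elements, where
  \<open>d = CARD('d)\<close> and \<open>k = CARD('k)\<close>.
\<close>

type_synonym ('d, 'k) blocks = "unit + 'd + 'k \<times> 'd"

definition block ::
  "real \<Rightarrow> real ^ 'd \<Rightarrow> ('k \<Rightarrow> real ^ 'd) \<Rightarrow> real ^ ('d::finite, 'k::finite) blocks" where
  "block u v w =
     (\<chi> s. case s of Inl _ \<Rightarrow> u | Inr (Inl i) \<Rightarrow> v $ i | Inr (Inr (p, i)) \<Rightarrow> w p $ i)"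

definition u_part :: "real ^ ('d::finite, 'k::finite) blocks \<Rightarrow> real" where
  "u_part x = x $ Inl ()"

definition v_part :: "real ^ ('d::finite, 'k::finite) blocks \<Rightarrow> real ^ 'd" where
  "v_part x = (\<chi> i. x $ Inr (Inl i))"

definition block_action :: "real \<Rightarrow> ('k \<Rightarrow> real) \<Rightarrow> real ^ 'd \<Rightarrow>
    real ^ ('d::finite, 'k::finite) blocks \<Rightarrow> real ^ ('d, 'k) blocks" where
  "block_action c a \<xi> x =
     block (\<xi> \<bullet> v_part x) ((c\<^sup>2 * u_part x) *\<^sub>R \<xi>) (\<lambda>p. (- a p * u_part x) *\<^sub>R \<xi>)"

definition A_mat :: "real \<Rightarrow> ('k \<Rightarrow> real) \<Rightarrow> 'd \<Rightarrow>
    real ^ ('d::finite, 'k::finite) blocks ^ ('d, 'k) blocks" where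
  "A_mat c a j = matrix (block_action c a (axis j 1))"

lemma card_blocks:
  "CARD(('d::finite, 'k::finite) blocks) = CARD('k) * CARD('d) + CARD('d) + 1"
  by (simp add: card_UNIV_sum)

lemma u_part_block [simp]: "u_part (block u v w) = u"
  by (simp add: u_part_def block_def)

lemma v_part_block [simp]: "v_part (block u v w) = v"
  by (simp add: v_part_def block_def vec_eq_iff)

lemma linear_block_action: "linear (block_action c a \<xi>)"
  by (rule linearI)
    (auto simp: vec_eq_iff block_action_def block_def u_part_def v_part_def inner_vec_def
      algebra_simps sum.distrib sum_distrib_left split: sum.splits)

lemma block_action_sum:
  "block_action c a \<xi> x = (\<Sum>j\<in>UNIV. \<xi> $ j *\<^sub>R block_action c a (axis j 1) x)"
  by (auto simp: vec_eq_iff block_action_def block_def inner_vec_def axis_def if_distrib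
      if_distribR algebra_simps sum.delta cong: if_cong split: sum.splits)

text \<open>The defining property of the matrices \<open>A\<^sub>j\<close>.\<close>

lemma symbol_A_mat:
  "symbol (A_mat c a) \<xi> *v block u v w =
     block (\<xi> \<bullet> v) ((c\<^sup>2 * u) *\<^sub>R \<xi>) (\<lambda>p. (- a p * u) *\<^sub>R \<xi>)"
proof -
  have "symbol (A_mat c a) \<xi> *v x = block_action c a \<xi> x" for x
  proof -
    have "symbol (A_mat c a) \<xi> *v x = (\<Sum>j\<in>UNIV. (\<xi> $ j *\<^sub>R A_mat c a j) *v x)"
      unfolding symbol_def by (induction rule: infinite_finite_induct)
        (auto simp: matrix_vector_mult_add_rdistrib)
    also have "\<dots> = (\<Sum>j\<in>UNIV. \<xi> $ j *\<^sub>R block_action c a (axis j 1) x)"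
      by (simp add: scaleR_matrix_vector_assoc [symmetric] A_mat_def matrix_works
          linear_block_action [unfolded linear_def, folded scalar_mult_eq_scaleR])
    finally show ?thesis
      by (simp add: block_action_sum [symmetric])
  qed
  then show ?thesis
    by (simp add: block_action_def)
qed

end

theory Submission
  imports Defs
begin

text \<open>
  For a unit vector \<open>\<xi>\<close> the symbol \<open>A(\<xi>)\<close> couples the components \<open>v, w\<^sub>1, \<dots>, w\<^sub>k\<close> only
  through the scalar \<open>u\<close>: all its nonzero entries lie in the row \<open>p = (0, \<xi>, 0, \<dots>, 0)\<close> and in the
  column \<open>q = (0, c\<^sup>2 \<xi>, - a\<^sub>1 \<xi>, \<dots>, - a\<^sub>k \<xi>)\<close> that cross at the position of \<open>u\<close>
  (\<open>symbol_A_mat_eq_cross_matrix\<close>). The spectrum of such a cross depends only on the number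
  \<open>p \<bullet> q\<close>, which equals \<open>c\<^sup>2 |\<xi>|\<^sup>2\<close>; the values \<open>a\<^sub>r\<close> cancel because \<open>p\<close> vanishes where
  they occur. With \<open>N\<close> the size of the matrix, one step of Gauss elimination gives the
  characteristic polynomial \<open>X\<^bsup>N-2\<^esup> (X\<^sup>2 - p \<bullet> q)\<close> (\<open>det_mat_plus_cross_matrix\<close>,
  \<open>charpoly_cross_matrix\<close>). The kernel is the orthogonal complement of \<open>p\<close> and the unit vector of
  \<open>u\<close>, of dimension \<open>N - 2\<close>, and for \<open>\<mu> = \<plusminus> c\<close> the eigenspace is the line through \<open>(\<mu>, q)\<close>, so
  that every eigenvalue is semi-simple (\<open>semisimple_cross_matrix\<close>).

  It remains to see that \<open>\<xi> \<mapsto> \<plusminus> c |\<xi>|\<close> is analytic away from the origin. Around \<open>x \<noteq> 0\<close> one has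
  \<open>|x + h| = |x| (1 + s)\<^bsup>1/2\<^esup>\<close> with \<open>s = (2 x \<bullet> h + |h|\<^sup>2) / |x|\<^sup>2\<close>, and substituting this
  polynomial into the binomial series yields a power series in \<open>h\<close>
  (\<open>real_analytic_at_power_series_of_polynomial\<close>). The substitution is organised by words:
  \<open>s\<^sup>n\<close> is the sum, over all words of length \<open>n\<close> in the monomials of \<open>s\<close>, of the product of the
  letters. The resulting family over all words is absolutely summable, so it may be summed by
  length, which gives back the function, or by exponent, which gives the power series.
\<close>

section \<open>Analyticity of multiples of the norm\<close>

text \<open>
  The regrouping that passes from words to their lengths, and from words to their multi-indices.
  In both cases only finitely many words share a value, so that the regrouped terms are honest
  finite sums.
\<close>

lemma has_sum_group_fibres:
  fixes f :: "'a \<Rightarrow> real" and g :: "'a \<Rightarrow> 'b"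
  assumes "(f has_sum s) UNIV" and fin: "\<And>b. finite {w. g w = b}"
  shows "((\<lambda>b. \<Sum>w | g w = b. f w) has_sum s) UNIV"
proof -
  have inj: "inj_on (\<lambda>w. (g w, w)) UNIV"
    by (auto intro: inj_onI)
  have img: "range (\<lambda>w. (g w, w)) = (SIGMA b:UNIV. {w. g w = b})"
    by auto
  have "((\<lambda>(b, w). f w) has_sum s) (SIGMA b:UNIV. {w. g w = b})"
    using assms(1) unfolding img [symmetric] has_sum_reindex [OF inj] by (simp add: o_def)
  moreover have "((\<lambda>w. f w) has_sum (\<Sum>w | g w = b. f w)) {w. g w = b}" for b
    using fin by (simp add: has_sum_finite)
  ultimately show ?thesis
    by (auto intro: has_sum_SigmaD)
qed

lemma finite_words_length: "finite {w :: 'a::finite list. length w = n}"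
  using finite_lists_length_eq [of "UNIV :: 'a set" n] by simp

lemma sum_words_length:
  fixes t :: "'a::finite \<Rightarrow> real"
  shows "(\<Sum>w | length w = n. \<Prod>a\<leftarrow>w. t a) = (\<Sum>a\<in>UNIV. t a) ^ n"
proof (induction n)
  case 0
  then show ?case by simp
next
  case (Suc n)
  have inj: "inj_on (\<lambda>(a, w). a # w) (UNIV \<times> {w :: 'a list. length w = n})"
    by (auto intro: inj_onI)
  have "{w :: 'a list. length w = Suc n} = (\<lambda>(a, w). a # w) ` (UNIV \<times> {w. length w = n})"
    by (auto simp: length_Suc_conv image_iff)
  then have "(\<Sum>w | length w = Suc n. \<Prod>a\<leftarrow>w. t a)
      = (\<Sum>(a, w)\<in>UNIV \<times> {w. length w = n}. t a * (\<Prod>a\<leftarrow>w. t a))"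
    by (simp only: sum.reindex [OF inj]) (simp add: o_def case_prod_unfold)
  also have "\<dots> = (\<Sum>a\<in>UNIV. t a) * (\<Sum>w | length w = n. \<Prod>a\<leftarrow>w. t a)"
    by (simp add: sum.cartesian_product [symmetric] sum_product)
  finally show ?case
    using Suc by simp
qed

lemma abs_prod_list: "\<bar>\<Prod>a\<leftarrow>w. t a\<bar> = (\<Prod>a\<leftarrow>w. \<bar>t a :: real\<bar>)"
  by (induction w) (auto simp: abs_mult)

text \<open>
  Summability holds because the sum of the absolute values over the words of length \<open>n\<close> is again
  a term of the series, formed with \<open>|t|\<close> in place of \<open>t\<close>; the hypothesis is exactly that this
  majorant converges.
\<close>

lemma power_series_word_expansion:
  fixes t :: "'a::finite \<Rightarrow> real" and c :: "nat \<Rightarrow> real"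
  assumes summ: "summable (\<lambda>n. \<bar>c n\<bar> * (\<Sum>a\<in>UNIV. \<bar>t a\<bar>) ^ n)"
  shows "((\<lambda>w. c (length w) * (\<Prod>a\<leftarrow>w. t a)) has_sum (\<Sum>n. c n * (\<Sum>a\<in>UNIV. t a) ^ n)) UNIV"
proof -
  define f where "f = (\<lambda>w. c (length w) * (\<Prod>a\<leftarrow>w. t a))"
  let ?S = "\<Sum>a\<in>UNIV. \<bar>t a\<bar>"
  have level: "(\<Sum>w | length w = n. \<bar>f w\<bar>) = \<bar>c n\<bar> * ?S ^ n" for n
  proof -
    have "(\<Sum>w | length w = n. \<bar>f w\<bar>) = (\<Sum>w | length w = n. \<bar>c n\<bar> * (\<Prod>a\<leftarrow>w. \<bar>t a\<bar>))"
      by (rule sum.cong) (auto simp: f_def abs_mult abs_prod_list)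
    then show ?thesis
      by (simp add: sum_distrib_left [symmetric] sum_words_length)
  qed
  have bound: "(\<Sum>w\<in>F. \<bar>f w\<bar>) \<le> (\<Sum>n. \<bar>c n\<bar> * ?S ^ n)" if "finite F" for F
  proof -
    define N where "N = Suc (Max (insert 0 (length ` F)))"
    have N: "length w < N" if "w \<in> F" for w
      using that \<open>finite F\<close> by (auto simp: N_def less_Suc_eq_le intro!: Max_ge)
    have "(\<Sum>w\<in>F. \<bar>f w\<bar>) \<le> (\<Sum>w\<in>(\<Union>n<N. {w. length w = n}). \<bar>f w\<bar>)"
      using N by (intro sum_mono2) (auto intro: finite_words_length)
    also have "\<dots> = (\<Sum>n<N. \<Sum>w | length w = n. \<bar>f w\<bar>)"
      by (rule sum.UNION_disjoint) (auto intro: finite_words_length)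
    also have "\<dots> = (\<Sum>n<N. \<bar>c n\<bar> * ?S ^ n)"
      by (simp add: level)
    also have "\<dots> \<le> (\<Sum>n. \<bar>c n\<bar> * ?S ^ n)"
      by (rule sum_le_suminf [OF summ]) (auto intro!: mult_nonneg_nonneg zero_le_power sum_nonneg)
    finally show ?thesis .
  qed
  have "(\<lambda>w. norm (f w)) summable_on UNIV"
    by (rule nonneg_bdd_above_summable_on) (auto intro!: bdd_aboveI2 bound)
  then have "f summable_on UNIV"
    by (rule abs_summable_summable)
  then obtain s where s: "(f has_sum s) UNIV"
    by (auto simp: summable_on_def)
  have level': "(\<Sum>w | length w = n. f w) = c n * (\<Sum>a\<in>UNIV. t a) ^ n" for n
  proof -
    have "(\<Sum>w | length w = n. f w) = (\<Sum>w | length w = n. c n * (\<Prod>a\<leftarrow>w. t a))"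
      by (rule sum.cong) (auto simp: f_def)
    then show ?thesis
      by (simp add: sum_distrib_left [symmetric] sum_words_length)
  qed
  have "((\<lambda>n. \<Sum>w | length w = n. f w) has_sum s) UNIV"
    by (rule has_sum_group_fibres [OF s finite_words_length])
  then have "(\<lambda>n. c n * (\<Sum>a\<in>UNIV. t a) ^ n) sums s"
    unfolding level' by (rule has_sum_imp_sums)
  then have "s = (\<Sum>n. c n * (\<Sum>a\<in>UNIV. t a) ^ n)"
    by (rule sums_unique)
  with s show ?thesis
    by (simp add: f_def)
qed

lemma prod_list_monomials:
  fixes h :: "'d::finite \<Rightarrow> real"
  shows "(\<Prod>a\<leftarrow>w. \<kappa> a * (\<Prod>j\<in>UNIV. h j ^ m a j))
    = (\<Prod>a\<leftarrow>w. \<kappa> a) * (\<Prod>j\<in>UNIV. h j ^ (\<Sum>a\<leftarrow>w. m a j))"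
  by (induction w) (auto simp: power_add prod.distrib)

text \<open>
  Monomials without constant term: each letter raises the total degree by at least one, so the
  multi-index of a word bounds its length.
\<close>

lemma finite_words_exponent:
  fixes m :: "'a::finite \<Rightarrow> 'd::finite \<Rightarrow> nat"
  assumes nz: "\<And>a. \<exists>j. m a j \<noteq> 0"
  shows "finite {w. (\<lambda>j. \<Sum>a\<leftarrow>w. m a j) = \<alpha>}"
proof (rule finite_subset)
  have len: "length w \<le> (\<Sum>j\<in>UNIV. \<Sum>a\<leftarrow>w. m a j)" for w
  proof (induction w)
    case (Cons a w)
    have "(\<Sum>j\<in>UNIV. m a j) \<noteq> 0"
      using nz [of a] by (simp add: sum_eq_0_iff)
    with Cons show ?case
      unfolding list.map sum_list.Cons list.size sum.distrib by linarith
  qed simp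
  show "{w. (\<lambda>j. \<Sum>a\<leftarrow>w. m a j) = \<alpha>} \<subseteq> {w. set w \<subseteq> UNIV \<and> length w \<le> (\<Sum>j\<in>UNIV. \<alpha> j)}"
    using len by auto
  show "finite {w :: 'a list. set w \<subseteq> UNIV \<and> length w \<le> (\<Sum>j\<in>UNIV. \<alpha> j)}"
    by (rule finite_lists_length_le) simp
qed

text \<open>
  The inner polynomial has no constant term, so near \<open>x\<close> even the sum of the absolute values of its
  monomials stays below the radius of convergence \<open>R\<close>. This is what makes the expansion into words
  absolutely convergent.
\<close>

lemma real_analytic_at_power_series_of_polynomial:
  fixes f :: "real ^ 'd \<Rightarrow> real" and \<kappa> :: "'a::finite \<Rightarrow> real" and m :: "'a \<Rightarrow> 'd \<Rightarrow> nat"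
  assumes nz: "\<And>a. \<exists>j. m a j \<noteq> 0" and "R > 0"
    and g: "\<And>t. \<bar>t\<bar> < R \<Longrightarrow> (\<lambda>n. c n * t ^ n) sums g t"
    and f: "\<And>y. f y = g (\<Sum>a\<in>UNIV. \<kappa> a * (\<Prod>j\<in>UNIV. (y $ j - x $ j) ^ m a j))"
  shows "real_analytic_at f x"
proof -
  define t where "t = (\<lambda>y a. \<kappa> a * (\<Prod>j\<in>UNIV. (y $ j - x $ j) ^ m a j))"
  define e where "e = (\<lambda>w j. \<Sum>a\<leftarrow>w. m a j)"
  define C where "C = (\<lambda>\<alpha>. \<Sum>w | e w = \<alpha>. c (length w) * (\<Prod>a\<leftarrow>w. \<kappa> a))"
  have t0: "t x a = 0" for a
    using nz [of a] by (auto simp: t_def power_0_left)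
  have "((\<lambda>y. \<Sum>a\<in>UNIV. \<bar>t y a\<bar>) \<longlongrightarrow> (\<Sum>a\<in>UNIV. \<bar>t x a\<bar>)) (nhds x)"
    unfolding t_def by (intro tendsto_intros filterlim_ident)
  then have "\<forall>\<^sub>F y in nhds x. (\<Sum>a\<in>UNIV. \<bar>t y a\<bar>) < R"
    using \<open>R > 0\<close> by (intro order_tendstoD) (auto simp: t0)
  then obtain r where "r > 0" and r: "\<And>y. dist y x < r \<Longrightarrow> (\<Sum>a\<in>UNIV. \<bar>t y a\<bar>) < R"
    by (auto simp: eventually_nhds_metric)
  have "((\<lambda>\<alpha>. C \<alpha> * (\<Prod>j\<in>UNIV. (y $ j - x $ j) ^ \<alpha> j)) has_sum f y) UNIV"
    if "y \<in> ball x r" for y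
  proof -
    let ?S = "\<Sum>a\<in>UNIV. \<bar>t y a\<bar>"
    have S: "?S < R"
      using that r by (simp add: dist_commute)
    have S0: "0 \<le> ?S"
      by (simp add: sum_nonneg)
    (* A point strictly between the majorant and R turns the convergence of the series in one
       variable into absolute convergence at the majorant. *)
    obtain \<rho> where \<rho>: "?S < \<rho>" "\<rho> < R"
      using S dense by blast
    have "summable (\<lambda>n. c n * \<rho> ^ n)"
      using g [of \<rho>] \<rho> S0 by (auto simp: sums_iff)
    then have "summable (\<lambda>n. norm (c n * ?S ^ n))"
      by (rule powser_insidea) (use \<rho> S0 in auto)
    then have "summable (\<lambda>n. \<bar>c n\<bar> * ?S ^ n)"
      using S0 by (simp add: abs_mult power_abs)
    then have "((\<lambda>w. c (length w) * (\<Prod>a\<leftarrow>w. t y a)) has_sum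
        (\<Sum>n. c n * (\<Sum>a\<in>UNIV. t y a) ^ n)) UNIV"
      by (rule power_series_word_expansion)
    moreover have "\<bar>\<Sum>a\<in>UNIV. t y a\<bar> < R"
      using S sum_abs [of "t y" UNIV] by linarith
    then have "(\<Sum>n. c n * (\<Sum>a\<in>UNIV. t y a) ^ n) = f y"
      using g by (simp add: sums_iff f t_def)
    ultimately have "((\<lambda>w. c (length w) * (\<Prod>a\<leftarrow>w. t y a)) has_sum f y) UNIV"
      by simp
    then have "((\<lambda>\<alpha>. \<Sum>w | e w = \<alpha>. c (length w) * (\<Prod>a\<leftarrow>w. t y a)) has_sum f y) UNIV"
      by (rule has_sum_group_fibres) (unfold e_def, rule finite_words_exponent [OF nz])
    moreover have "(\<Sum>w | e w = \<alpha>. c (length w) * (\<Prod>a\<leftarrow>w. t y a))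
        = C \<alpha> * (\<Prod>j\<in>UNIV. (y $ j - x $ j) ^ \<alpha> j)" for \<alpha>
      unfolding C_def sum_distrib_right
      by (rule sum.cong) (auto simp: t_def prod_list_monomials e_def)
    ultimately show ?thesis
      by simp
  qed
  with \<open>r > 0\<close> show ?thesis
    unfolding real_analytic_at_def by blast
qed

text \<open>
  The letters \<open>(j, False)\<close> and \<open>(j, True)\<close> stand for the linear monomial \<open>2 x\<^sub>j h\<^sub>j / |x|\<^sup>2\<close> and the
  quadratic one \<open>h\<^sub>j\<^sup>2 / |x|\<^sup>2\<close> of \<open>|x + h|\<^sup>2 / |x|\<^sup>2 - 1\<close>.
\<close>

lemma real_analytic_at_norm:
  fixes x :: "real ^ 'd"
  assumes "x \<noteq> 0"
  shows "real_analytic_at (\<lambda>y. C * norm y) x"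
proof -
  define \<kappa> where "\<kappa> = (\<lambda>(j, sq). (if sq then 1 else 2 * x $ j) / (norm x)\<^sup>2)"
  define m :: "'d \<times> bool \<Rightarrow> 'd \<Rightarrow> nat"
    where "m = (\<lambda>(j, sq) i. if i = j then if sq then 2 else 1 else 0)"
  show ?thesis
  proof (rule real_analytic_at_power_series_of_polynomial [where m = m and \<kappa> = \<kappa> and R = 1
        and c = "\<lambda>n. C * norm x * (1/2 gchoose n)" and g = "\<lambda>t. C * norm x * (1 + t) powr (1/2)"])
    show "\<exists>j. m a j \<noteq> 0" for a
      by (cases a) (auto simp: m_def)
    show "(\<lambda>n. C * norm x * (1/2 gchoose n) * t ^ n) sums (C * norm x * (1 + t) powr (1/2))"
      if "\<bar>t\<bar> < 1" for t
      using sums_mult [OF gen_binomial_real [OF that, of "1/2"], of "C * norm x"]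
      by (simp add: mult.assoc)
    show "C * norm y = C * norm x *
        (1 + (\<Sum>a\<in>UNIV. \<kappa> a * (\<Prod>j\<in>UNIV. (y $ j - x $ j) ^ m a j))) powr (1/2)" for y
    proof -
      have mon: "(\<Prod>i\<in>UNIV. (y $ i - x $ i) ^ m (j, sq) i)
          = (y $ j - x $ j) ^ (if sq then 2 else 1)" for j sq
      proof -
        have "(\<Prod>i\<in>UNIV. (y $ i - x $ i) ^ m (j, sq) i)
            = (\<Prod>i\<in>UNIV. if i = j then (y $ j - x $ j) ^ (if sq then 2 else 1) else 1)"
          by (rule prod.cong) (auto simp: m_def)
        then show ?thesis by simp
      qed
      have "(\<Sum>a\<in>UNIV. \<kappa> a * (\<Prod>j\<in>UNIV. (y $ j - x $ j) ^ m a j))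
          = (\<Sum>j\<in>UNIV. \<Sum>sq\<in>UNIV. \<kappa> (j, sq) * (y $ j - x $ j) ^ (if sq then 2 else 1))"
        unfolding UNIV_Times_UNIV [symmetric] sum.cartesian_product
        by (rule sum.cong) (auto simp: mon)
      also have "\<dots> = (\<Sum>j\<in>UNIV. ((y $ j)\<^sup>2 - (x $ j)\<^sup>2) / (norm x)\<^sup>2)"
        by (rule sum.cong) (simp_all add: UNIV_bool \<kappa>_def add_divide_distrib [symmetric]
            power2_eq_square algebra_simps)
      also have "\<dots> = ((norm y)\<^sup>2 - (norm x)\<^sup>2) / (norm x)\<^sup>2"
        by (simp add: sum_divide_distrib [symmetric] sum_subtractf power2_norm_eq_inner
            inner_vec_def) (simp add: power2_eq_square)
      finally have "1 + (\<Sum>a\<in>UNIV. \<kappa> a * (\<Prod>j\<in>UNIV. (y $ j - x $ j) ^ m a j))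
          = (norm y / norm x)\<^sup>2"
        using assms by (simp add: field_simps)
      then show ?thesis
        using assms by (simp add: powr_half_sqrt)
    qed
  qed simp
qed


section \<open>Matrices supported on one row and one column\<close>

definition cross_matrix :: "'n \<Rightarrow> ('n \<Rightarrow> 'a) \<Rightarrow> ('n \<Rightarrow> 'a) \<Rightarrow> 'a::comm_ring_1 ^ 'n ^ 'n" where
  "cross_matrix k p q = (\<chi> i j. (if i = k then p j else 0) + (if j = k then q i else 0))"

lemma cross_matrix_mult_vec:
  "(cross_matrix k p q *v x) $ i = (if i = k then \<Sum>j\<in>UNIV. p j * x $ j else 0) + q i * x $ k"
  by (auto simp: cross_matrix_def matrix_vector_mult_def distrib_right sum.distrib if_distribR
      if_distrib [of "\<lambda>z. z * _"] cong: if_cong)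

text \<open>
  A permutation that moves one index moves at least two, and one of them differs from \<open>k\<close>; hence
  only the identity contributes to the Leibniz formula. This serves as a triangularity criterion for
  index types without an order.
\<close>

lemma det_offdiagonal_in_row:
  fixes B :: "'a::comm_ring_1 ^ 'n ^ 'n"
  assumes B: "\<And>i j. i \<noteq> j \<Longrightarrow> i \<noteq> k \<Longrightarrow> B $ i $ j = 0"
  shows "det B = (\<Prod>i\<in>UNIV. B $ i $ i)"
proof -
  have zero: "of_int (sign \<pi>) * (\<Prod>i\<in>UNIV. B $ i $ \<pi> i) = 0"
    if "\<pi> permutes UNIV" "\<pi> \<noteq> id" for \<pi>
  proof -
    obtain i where i: "\<pi> i \<noteq> i"
      using \<open>\<pi> \<noteq> id\<close> by (auto simp: fun_eq_iff)
    have "\<pi> (\<pi> i) \<noteq> \<pi> i"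
      using i permutes_inj [OF that(1)] by (auto dest: injD)
    with i obtain i' where "i' \<noteq> k" "\<pi> i' \<noteq> i'"
      by metis
    then have "(\<Prod>i\<in>UNIV. B $ i $ \<pi> i) = 0"
      using B [of i' "\<pi> i'"] by (intro prod_zero) force+
    then show ?thesis
      by simp
  qed
  have "det B = (\<Sum>\<pi>\<in>{id}. of_int (sign \<pi>) * (\<Prod>i\<in>UNIV. B $ i $ \<pi> i))"
    unfolding det_def using zero
    by (intro sum.mono_neutral_right) (auto simp: finite_permutations permutes_id)
  then show ?thesis
    by simp
qed

lemma det_offdiagonal_in_column:
  fixes B :: "'a::comm_ring_1 ^ 'n ^ 'n"
  assumes "\<And>i j. i \<noteq> j \<Longrightarrow> j \<noteq> k \<Longrightarrow> B $ i $ j = 0"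
  shows "det B = (\<Prod>i\<in>UNIV. B $ i $ i)"
proof -
  have "det (transpose B) = (\<Prod>i\<in>UNIV. transpose B $ i $ i)"
    by (rule det_offdiagonal_in_row [of k]) (simp add: transpose_def assms)
  then show ?thesis
    by (simp add: det_transpose) (simp add: transpose_def)
qed

text \<open>
  Multiplying the matrix from the left by \<open>L\<close> replaces row \<open>k\<close> by \<open>x\<close> times itself minus the
  combination of the other rows with coefficients \<open>p\<close>; this clears row \<open>k\<close> outside the diagonal.
  Scaling by \<open>x\<close> instead of dividing by it keeps the identity valid in every commutative ring,
  so that it applies to real numbers and to the indeterminate of a polynomial ring alike.
\<close>

lemma det_mat_plus_cross_matrix:
  fixes x :: "'a::comm_ring_1" and p q :: "'n::finite \<Rightarrow> 'a"
  assumes "p k = 0" "q k = 0"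
  shows "x * det (mat x + cross_matrix k p q)
    = x ^ (CARD('n) - 1) * (x\<^sup>2 - (\<Sum>j\<in>UNIV. p j * q j))"
proof -
  define L :: "'a ^ 'n ^ 'n"
    where "L = (\<chi> i j. if i = k then if j = k then x else - p j else if i = j then 1 else 0)"
  define B where "B = mat x + cross_matrix k p q"
  have diag: "(\<Prod>i\<in>UNIV. if i = k then s else t) = s * t ^ (CARD('n) - 1)" for s t :: 'a
  proof -
    have "(\<Prod>i\<in>UNIV. if i = k then s else t) = s * (\<Prod>i\<in>UNIV - {k}. if i = k then s else t)"
      by (subst prod.remove [of _ k]) auto
    also have "(\<Prod>i\<in>UNIV - {k}. if i = k then s else t) = (\<Prod>i\<in>UNIV - {k}. t)"
      by (rule prod.cong) auto
    finally show ?thesis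
      by (simp add: card_Diff_singleton)
  qed
  have LB: "(L ** B) $ i $ j = (if i = k then if j = k then x\<^sup>2 - (\<Sum>l\<in>UNIV. p l * q l) else 0
      else if i = j then x else if j = k then q i else 0)" for i j
  proof (cases "i = k")
    case True
    have "(L ** B) $ i $ j = (\<Sum>l\<in>UNIV. (if l = k then x * B $ l $ j else 0) - p l * B $ l $ j)"
      unfolding matrix_matrix_mult_def using True assms
      by (auto simp: L_def intro!: sum.cong)
    also have "\<dots> = x * B $ k $ j - (\<Sum>l\<in>UNIV. p l * B $ l $ j)"
      by (simp add: sum_subtractf)
    also have "(\<Sum>l\<in>UNIV. p l * B $ l $ j)
        = (\<Sum>l\<in>UNIV. (if l = j then p j * x else 0) + (if j = k then p l * q l else 0))"
      by (rule sum.cong) (use assms in \<open>auto simp: B_def cross_matrix_def mat_def algebra_simps\<close>)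
    also have "\<dots> = p j * x + (if j = k then \<Sum>l\<in>UNIV. p l * q l else 0)"
      by (simp add: sum.distrib)
    finally show ?thesis
      using True assms
      by (auto simp: B_def cross_matrix_def mat_def power2_eq_square algebra_simps)
  next
    case False
    have "(L ** B) $ i $ j = (\<Sum>l\<in>UNIV. if l = i then B $ i $ j else 0)"
      unfolding matrix_matrix_mult_def vec_lambda_beta
      by (rule sum.cong) (use False in \<open>auto simp: L_def\<close>)
    then show ?thesis
      using False by (auto simp: B_def cross_matrix_def mat_def)
  qed
  have "det L = (\<Prod>i\<in>UNIV. L $ i $ i)"
    by (rule det_offdiagonal_in_row [of k]) (simp add: L_def)
  also have "\<dots> = (\<Prod>i\<in>UNIV. if i = k then x else 1)"
    by (rule prod.cong) (auto simp: L_def)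
  finally have detL: "det L = x"
    by (simp add: diag)
  have "det (L ** B) = (\<Prod>i\<in>UNIV. (L ** B) $ i $ i)"
    by (rule det_offdiagonal_in_column [of k]) (auto simp: LB)
  also have "\<dots> = (\<Prod>i\<in>UNIV. if i = k then x\<^sup>2 - (\<Sum>l\<in>UNIV. p l * q l) else x)"
    by (rule prod.cong) (auto simp: LB)
  finally show ?thesis
    by (simp add: diag det_mul detL B_def mult.commute)
qed

lemma charpoly_cross_matrix:
  fixes p q :: "'n::finite \<Rightarrow> real"
  assumes "p k = 0" "q k = 0" "CARD('n) \<ge> 2"
  shows "charpoly (cross_matrix k p q)
    = [:0, 1:] ^ (CARD('n) - 2) * [:- (\<Sum>j\<in>UNIV. p j * q j), 0, 1:]"
proof -
  let ?X = "[:0, 1:] :: real poly"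
  have sum_const: "(\<Sum>j\<in>I. [:r j:]) = [:\<Sum>j\<in>I. r j:]" for r :: "'n \<Rightarrow> real" and I
    by (induction I rule: infinite_finite_induct) auto
  have "charpoly (cross_matrix k p q)
      = det (mat ?X + cross_matrix k (\<lambda>j. [:- p j:]) (\<lambda>i. [:- q i:]))"
    unfolding charpoly_def
    by (rule arg_cong [where f = det]) (auto simp: vec_eq_iff mat_def cross_matrix_def)
  then have "?X * charpoly (cross_matrix k p q)
      = ?X ^ (CARD('n) - 1) * (?X\<^sup>2 - [:\<Sum>j\<in>UNIV. p j * q j:])"
    using det_mat_plus_cross_matrix [of "\<lambda>j. [:- p j:]" k "\<lambda>i. [:- q i:]" ?X] assms
    by (simp only: sum_const mult_pCons_left mult_pCons_right) (simp add: sum_const mult.commute)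
  also have "?X\<^sup>2 - [:\<Sum>j\<in>UNIV. p j * q j:] = [:- (\<Sum>j\<in>UNIV. p j * q j), 0, 1:]"
    by (simp add: power2_eq_square)
  also have "CARD('n) - 1 = Suc (CARD('n) - 2)"
    using assms(3) by simp
  finally have "?X * charpoly (cross_matrix k p q)
      = ?X * (?X ^ (CARD('n) - 2) * [:- (\<Sum>j\<in>UNIV. p j * q j), 0, 1:])"
    by (simp only: power_Suc mult.assoc)
  then show ?thesis
    by (subst (asm) mult_left_cancel) auto
qed

text \<open>
  Inserting the equations of the rows \<open>j \<noteq> k\<close> into that of row \<open>k\<close> gives
  \<open>\<mu>\<^sup>2 x\<^sub>k = (p \<bullet> q) x\<^sub>k\<close>, and \<open>x\<^sub>k = 0\<close> forces \<open>\<mu> x = 0\<close>. The field is arbitrary because the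
  complexified symbol has to be covered.
\<close>

lemma cross_matrix_eigenvalue_cases:
  fixes p q :: "'n::finite \<Rightarrow> 'a::field"
  assumes "p k = 0" "q k = 0" "is_eigenvalue (cross_matrix k p q) \<mu>"
  shows "\<mu> = 0 \<or> \<mu>\<^sup>2 = (\<Sum>j\<in>UNIV. p j * q j)"
proof -
  obtain x where "x \<noteq> 0" and x: "cross_matrix k p q *v x = \<mu> *s x"
    using assms(3) by (auto simp: is_eigenvalue_def)
  have xi: "(if i = k then \<Sum>j\<in>UNIV. p j * x $ j else 0) + q i * x $ k = \<mu> * x $ i" for i
    using x by (metis cross_matrix_mult_vec vector_smult_component)
  have pq: "p j * (\<mu> * x $ j) = p j * q j * x $ k" for j
    using xi [of j] assms by (cases "j = k") auto
  have "\<mu>\<^sup>2 * x $ k = \<mu> * (\<Sum>j\<in>UNIV. p j * x $ j)"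
    using xi [of k] assms by (simp add: power2_eq_square)
  also have "\<dots> = (\<Sum>j\<in>UNIV. p j * (\<mu> * x $ j))"
    by (simp add: sum_distrib_left mult.left_commute)
  also have "\<dots> = (\<Sum>j\<in>UNIV. p j * q j) * x $ k"
    by (simp add: pq sum_distrib_right)
  finally have k: "\<mu>\<^sup>2 * x $ k = (\<Sum>j\<in>UNIV. p j * q j) * x $ k" .
  show ?thesis
  proof (cases "x $ k = 0")
    case True
    then have "\<mu> * x $ i = 0" for i
      using xi [of i] by (cases "i = k") auto
    with \<open>x \<noteq> 0\<close> show ?thesis
      by (auto simp: vec_eq_iff)
  next
    case False
    with k show ?thesis by simp
  qed
qed

lemma eigenspace_cross_matrix_nonzero:
  fixes p q :: "'n::finite \<Rightarrow> real"
  assumes "p k = 0" "q k = 0" "\<mu> \<noteq> 0" "\<mu>\<^sup>2 = (\<Sum>j\<in>UNIV. p j * q j)"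
  shows "{x. cross_matrix k p q *v x = \<mu> *s x} = span {\<chi> i. if i = k then \<mu> else q i}"
    (is "?E = span {?v}")
proof (intro set_eqI iffI)
  fix x assume "x \<in> ?E"
  then have x: "cross_matrix k p q *v x = \<mu> *s x" by simp
  have xi: "(if i = k then \<Sum>j\<in>UNIV. p j * x $ j else 0) + q i * x $ k = \<mu> * x $ i" for i
    using x by (metis cross_matrix_mult_vec vector_smult_component)
  have "x $ i = ((x $ k / \<mu>) *\<^sub>R ?v) $ i" for i
    using xi [of i] assms(3) by (cases "i = k") (auto simp: field_simps)
  then have "x = (x $ k / \<mu>) *\<^sub>R ?v"
    unfolding vec_eq_iff by blast
  then show "x \<in> span {?v}"
    by (metis span_base span_scale singletonI)
next
  fix x assume "x \<in> span {?v}"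
  then obtain r where r: "x = r *\<^sub>R ?v"
    by (auto simp: span_singleton)
  have pq: "(\<Sum>j\<in>UNIV. p j * (r * (if j = k then \<mu> else q j))) = r * \<mu>\<^sup>2"
    unfolding assms(4) sum_distrib_left
    by (rule sum.cong) (use assms(1) in auto)
  have "cross_matrix k p q *v x = \<mu> *s x"
    unfolding vec_eq_iff r
    using pq assms(2) by (auto simp: cross_matrix_mult_vec power2_eq_square)
  then show "x \<in> ?E" by simp
qed

text \<open>
  Since \<open>q \<noteq> 0\<close>, the kernel equations reduce to \<open>x\<^sub>k = 0\<close> and \<open>p \<bullet> x = 0\<close>. These two conditions are
  independent because \<open>p\<close> is nonzero and vanishes at \<open>k\<close>.
\<close>

lemma dim_kernel_cross_matrix:
  fixes p q :: "'n::finite \<Rightarrow> real"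
  assumes "p k = 0" "q k = 0" "(\<Sum>j\<in>UNIV. p j * q j) \<noteq> 0"
  shows "dim {x. cross_matrix k p q *v x = 0 *s x} = CARD('n) - 2"
proof -
  obtain l where l: "p l \<noteq> 0" "q l \<noteq> 0"
    using assms(3) by (metis (no_types, lifting) mult_eq_0_iff sum.neutral)
  let ?e = "axis k 1 :: real ^ 'n" and ?p = "(\<chi> j. p j) :: real ^ 'n"
  have kernel: "{x. cross_matrix k p q *v x = 0 *s x}
      = {x \<in> UNIV. \<forall>y\<in>span {?e, ?p}. orthogonal y x}" (is "?K = ?O")
  proof (intro set_eqI iffI)
    fix x assume "x \<in> ?K"
    then have xi: "(if i = k then \<Sum>j\<in>UNIV. p j * x $ j else 0) + q i * x $ k = 0" for i
      by (metis (mono_tags, lifting) mem_Collect_eq cross_matrix_mult_vec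
          vector_smult_lzero zero_index)
    have "l \<noteq> k" using l assms by auto
    with xi [of l] l have xk: "x $ k = 0" by simp
    with xi [of k] have xp: "(\<Sum>j\<in>UNIV. p j * x $ j) = 0" by simp
    have "orthogonal x y" if "y \<in> span {?e, ?p}" for y
      by (rule orthogonal_to_span [OF that])
        (use xk xp in \<open>auto simp: orthogonal_def inner_axis inner_vec_def [of x "?p"] mult.commute\<close>)
    then show "x \<in> ?O"
      by (auto simp: orthogonal_commute)
  next
    fix x assume "x \<in> ?O"
    then have "orthogonal ?e x" "orthogonal ?p x"
      by (auto intro: span_base)
    then have "x $ k = 0" "(\<Sum>j\<in>UNIV. p j * x $ j) = 0"
      by (auto simp: orthogonal_def inner_axis' inner_vec_def [of "?p"])
    then show "x \<in> ?K"
      by (auto simp: vec_eq_iff cross_matrix_mult_vec)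
  qed
  have "?e \<notin> span {?p}"
  proof
    assume "?e \<in> span {?p}"
    then obtain r where "?e = r *\<^sub>R ?p"
      by (auto simp: span_singleton)
    then have "?e $ k = (r *\<^sub>R ?p) $ k" by simp
    then show False using assms(1) by simp
  qed
  moreover have "?p \<noteq> 0"
    using l by (auto simp: vec_eq_iff)
  ultimately have "independent {?e, ?p}" "?e \<noteq> ?p"
    by (auto simp: independent_insert intro: span_base)
  then have "dim (span {?e, ?p}) = 2"
    by (simp add: dim_eq_card_independent)
  moreover have "dim ?O + dim (span {?e, ?p}) = dim (UNIV :: (real ^ 'n) set)"
    by (rule dim_subspace_orthogonal_to_vectors) auto
  ultimately show ?thesis
    unfolding kernel by (simp only: dim_UNIV DIM_cart DIM_real)
qed

lemma semisimple_cross_matrix: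
  fixes p q :: "'n::finite \<Rightarrow> real"
  assumes pk: "p k = 0" and qk: "q k = 0" and c: "c > 0" "(\<Sum>j\<in>UNIV. p j * q j) = c\<^sup>2"
    and N: "CARD('n) \<ge> 3" and \<mu>: "\<mu> \<in> {- c, 0, c}"
  shows "semisimple_eigenvalue (cross_matrix k p q) \<mu>"
proof -
  let ?M = "cross_matrix k p q" and ?N = "CARD('n)"
  have geom: "geometric_multiplicity ?M \<mu> = (if \<mu> = 0 then ?N - 2 else 1)"
  proof (cases "\<mu> = 0")
    case True
    with c show ?thesis
      using dim_kernel_cross_matrix [of p k q] pk qk by (simp add: geometric_multiplicity_def)
  next
    case False
    let ?v = "(\<chi> i. if i = k then \<mu> else q i) :: real ^ 'n"
    have "?v $ k \<noteq> 0" using False by simp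
    then have "?v \<noteq> 0" by force
    moreover have "\<mu>\<^sup>2 = (\<Sum>j\<in>UNIV. p j * q j)"
      using \<mu> c False by auto
    ultimately show ?thesis
      using False eigenspace_cross_matrix_nonzero [of p k q \<mu>] pk qk
      by (simp add: geometric_multiplicity_def dim_singleton)
  qed
  have "[:- c\<^sup>2, 0, 1:] = [:- c, 1:] * [:- (- c), 1:]"
    by (simp add: power2_eq_square)
  then have char: "charpoly ?M = [:- 0, 1:] ^ (?N - 2) * ([:- c, 1:] ^ 1 * [:- (- c), 1:] ^ 1)"
    using charpoly_cross_matrix [of p k q] pk qk c N by simp
  have ord: "order r ([:- s, 1:] ^ n) = (if r = s then n else 0)" for r s :: real and n
  proof (cases "r = s")
    case True
    then show ?thesis by (simp only: order_power_n_n) simp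
  next
    case False
    then show ?thesis by (auto intro!: order_0I)
  qed
  have nz: "[:- s, 1:] ^ n \<noteq> 0" for s :: real and n
    by simp
  have "algebraic_multiplicity ?M \<mu> = order \<mu> ([:- 0, 1:] ^ (?N - 2)) +
      (order \<mu> ([:- c, 1:] ^ 1) + order \<mu> ([:- (- c), 1:] ^ 1))"
    unfolding algebraic_multiplicity_def char using nz
    by (simp only: order_mult mult_eq_0_iff simp_thms)
  also have "\<dots> = (if \<mu> = 0 then ?N - 2 else 1)"
    unfolding ord using \<mu> c by auto
  finally have alg: "algebraic_multiplicity ?M \<mu> = geometric_multiplicity ?M \<mu>"
    by (simp add: geom)
  have "dim {x. ?M *v x = \<mu> *s x} \<noteq> 0"
    using geom N by (simp add: geometric_multiplicity_def)
  then have "is_eigenvalue ?M \<mu>"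
    by (auto simp: is_eigenvalue_def)
  with alg show ?thesis
    by (simp add: semisimple_eigenvalue_def)
qed

lemma is_eigenvalue_complexification:
  fixes M :: "real ^ 'n ^ 'n"
  assumes "is_eigenvalue M \<mu>"
  shows "is_eigenvalue (map_matrix complex_of_real M) (complex_of_real \<mu>)"
proof -
  obtain x where "x \<noteq> 0" and x: "M *v x = \<mu> *s x"
    using assms by (auto simp: is_eigenvalue_def)
  have "(\<Sum>j\<in>UNIV. M $ i $ j * x $ j) = \<mu> * x $ i" for i
    using x by (simp add: vec_eq_iff matrix_vector_mult_def)
  then have "(\<Sum>j\<in>UNIV. complex_of_real (M $ i $ j) * complex_of_real (x $ j))
      = complex_of_real \<mu> * complex_of_real (x $ i)" for i
    by (metis (no_types, lifting) of_real_mult of_real_sum sum.cong)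
  then have "map_matrix complex_of_real M *v (\<chi> i. complex_of_real (x $ i))
      = complex_of_real \<mu> *s (\<chi> i. complex_of_real (x $ i))"
    by (simp add: vec_eq_iff matrix_vector_mult_def map_matrix_def)
  moreover have "(\<chi> i. complex_of_real (x $ i)) \<noteq> 0"
    using \<open>x \<noteq> 0\<close> by (auto simp: vec_eq_iff)
  ultimately show ?thesis
    by (auto simp: is_eigenvalue_def)
qed

lemma det_zero_if_eigenvalue_zero:
  fixes M :: "real ^ 'n ^ 'n"
  assumes "is_eigenvalue M 0"
  shows "det M = 0"
proof (rule ccontr)
  assume "det M \<noteq> 0"
  then have "\<exists>B. B ** M = mat 1"
    by (metis invertible_def invertible_det_nz)
  then have "\<forall>x. M *v x = 0 \<longrightarrow> x = 0"
    by (simp add: matrix_left_invertible_ker)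
  with assms show False
    by (auto simp: is_eigenvalue_def)
qed


section \<open>The symbol of the block operator\<close>

lemma symbol_A_mat_eq_cross_matrix:
  fixes c :: real and a :: "'k::finite \<Rightarrow> real" and \<xi> :: "real ^ 'd"
  defines "p \<equiv> \<lambda>s :: ('d, 'k) blocks. case s of Inr (Inl i) \<Rightarrow> \<xi> $ i | _ \<Rightarrow> 0"
    and "q \<equiv> \<lambda>s. case s of Inl _ \<Rightarrow> 0 | Inr (Inl i) \<Rightarrow> c\<^sup>2 * \<xi> $ i | Inr (Inr (r, i)) \<Rightarrow> - a r * \<xi> $ i"
  shows "symbol (A_mat c a) \<xi> = cross_matrix (Inl ()) p q"
    and "(\<Sum>s\<in>UNIV. p s * q s) = c\<^sup>2 * (norm \<xi>)\<^sup>2"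
proof -
  have blocks_sum: "(\<Sum>s\<in>UNIV. f s)
      = f (Inl ()) + ((\<Sum>i\<in>UNIV. f (Inr (Inl i))) + (\<Sum>z\<in>UNIV. f (Inr (Inr z))))"
    for f :: "('d, 'k) blocks \<Rightarrow> real"
    by (simp add: UNIV_Plus_UNIV [symmetric] sum.Plus UNIV_unit del: UNIV_Plus_UNIV)
  show "symbol (A_mat c a) \<xi> = cross_matrix (Inl ()) p q"
  proof (subst matrix_eq, rule allI)
    fix x :: "real ^ ('d, 'k) blocks"
    have x: "x = block (u_part x) (v_part x) (\<lambda>r. \<chi> i. x $ Inr (Inr (r, i)))"
      by (auto simp: vec_eq_iff block_def u_part_def v_part_def split: sum.splits)
    have "symbol (A_mat c a) \<xi> *v x = block (\<xi> \<bullet> v_part x) ((c\<^sup>2 * u_part x) *\<^sub>R \<xi>)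
        (\<lambda>r. (- a r * u_part x) *\<^sub>R \<xi>)"
      by (subst x, rule symbol_A_mat)
    also have "\<dots> = cross_matrix (Inl ()) p q *v x"
      unfolding vec_eq_iff cross_matrix_mult_vec blocks_sum
      by (auto simp: block_def u_part_def v_part_def p_def q_def inner_vec_def split: sum.splits)
    finally show "symbol (A_mat c a) \<xi> *v x = cross_matrix (Inl ()) p q *v x" .
  qed
  show "(\<Sum>s\<in>UNIV. p s * q s) = c\<^sup>2 * (norm \<xi>)\<^sup>2"
    unfolding blocks_sum power2_norm_eq_inner inner_vec_def
    by (simp add: p_def q_def sum_distrib_left mult.left_commute)
qed

theorem mainTheorem3:
  fixes c :: real
    and a b :: "'k::finite \<Rightarrow> real"
    and A :: "'d::finite \<Rightarrow> real ^ ('d, 'k) blocks ^ ('d, 'k) blocks"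
  assumes "c > 0"
    and "\<And>p. b p > 0"
    and "inj b"
    and "\<And>p. a p \<noteq> 0"
    and "A = A_mat c a"
  shows "constantly_hyperbolic A \<and>
    (\<exists>l lam. constantly_hyperbolic_with A 3 l lam \<and>
      lam 1 = (\<lambda>\<xi>. - c * norm \<xi>) \<and> lam 2 = (\<lambda>\<xi>. 0) \<and> lam 3 = (\<lambda>\<xi>. c * norm \<xi>) \<and>
      l 1 = 1 \<and> l 2 = CARD('k) * CARD('d) + CARD('d) - 1 \<and> l 3 = 1)"
proof -
  define \<sigma> where "\<sigma> = (\<lambda>i::nat. if i = 1 then - c else if i = 2 then 0 else c)"
  define lam :: "nat \<Rightarrow> real ^ 'd \<Rightarrow> real" where "lam = (\<lambda>i \<xi>. \<sigma> i * norm \<xi>)"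
  define l where "l = (\<lambda>i::nat. if i = 2 then CARD('k) * CARD('d) + CARD('d) - 1 else 1)"
  let ?N = "CARD(('d, 'k) blocks)"
  have idx: "{1..3} = {1, 2, 3 :: nat}"
    by auto
  have kd: "CARD('k) * CARD('d) \<ge> 1" "CARD('d) \<ge> 1"
    by (simp_all add: Suc_le_eq)
  have N: "?N \<ge> 3"
    using kd unfolding card_blocks by linarith
  have l2: "l 2 = ?N - 2"
    unfolding card_blocks l_def by simp
  have analytic: "real_analytic_on (lam i) (- {0})" for i
    by (auto simp: real_analytic_on_def lam_def intro: real_analytic_at_norm)
  have suml: "(\<Sum>i=1..3. l i) = ?N"
    unfolding idx using N l2 by (simp add: l_def)
  have sphere: "(\<forall>x::real. det (mat x + symbol A \<xi>) = (\<Prod>i=1..3. (x + lam i \<xi>) ^ l i)) \<and>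
        {z. is_eigenvalue (map_matrix complex_of_real (symbol A \<xi>)) z} =
          (\<lambda>i. complex_of_real (lam i \<xi>)) ` {1..3} \<and>
        (\<forall>i\<in>{1..3}. semisimple_eigenvalue (symbol A \<xi>) (lam i \<xi>)) \<and>
        (\<forall>i\<in>{1..3}. \<forall>j\<in>{1..3}. i < j \<longrightarrow> lam i \<xi> < lam j \<xi>)"
    if "\<xi> \<in> sphere 0 1" for \<xi>
  proof -
    have norm: "norm \<xi> = 1" and lam: "lam i \<xi> = \<sigma> i" for i
      using that by (auto simp: lam_def)
    define k :: "('d, 'k) blocks" where "k = Inl ()"
    obtain p q where M: "symbol A \<xi> = cross_matrix k p q" and pk: "p k = 0" and qk: "q k = 0"
      and pq: "(\<Sum>s\<in>UNIV. p s * q s) = c\<^sup>2"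
      using symbol_A_mat_eq_cross_matrix [where c = c and a = a and \<xi> = \<xi>] assms(5) norm
      by (auto simp: k_def)
    have semi: "semisimple_eigenvalue (symbol A \<xi>) \<mu>" if "\<mu> \<in> {- c, 0, c}" for \<mu>
      unfolding M using semisimple_cross_matrix [OF pk qk \<open>c > 0\<close> pq N that] .
    have eig: "is_eigenvalue (symbol A \<xi>) \<mu>" if "\<mu> \<in> {- c, 0, c}" for \<mu>
      using semi [OF that] by (simp add: semisimple_eigenvalue_def)
    have "det (mat x + symbol A \<xi>) = x ^ (?N - 2) * (x\<^sup>2 - c\<^sup>2)" for x
    proof (cases "x = 0")
      (* The determinant identity carries a factor x and is void for x = 0; there the kernel
         decides. *)
      case True
      then show ?thesis
        using det_zero_if_eigenvalue_zero [OF eig [of 0]] N by simp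
    next
      case False
      have "?N - 1 = Suc (?N - 2)"
        using N by linarith
      then have "x * det (mat x + symbol A \<xi>) = x * (x ^ (?N - 2) * (x\<^sup>2 - c\<^sup>2))"
        using det_mat_plus_cross_matrix [of p k q x] pk qk pq
        by (simp only: M power_Suc mult.assoc)
      with False show ?thesis by simp
    qed
    then have det: "det (mat x + symbol A \<xi>) = (\<Prod>i=1..3. (x + lam i \<xi>) ^ l i)" for x
      unfolding idx using l2 by (simp add: lam \<sigma>_def l_def power2_eq_square algebra_simps)
    have "z \<in> complex_of_real ` {- c, 0, c}"
      if "is_eigenvalue (map_matrix complex_of_real (symbol A \<xi>)) z" for z
    proof -
      have "map_matrix complex_of_real (symbol A \<xi>)
          = cross_matrix k (\<lambda>s. complex_of_real (p s)) (\<lambda>s. complex_of_real (q s))"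
        unfolding M by (auto simp: vec_eq_iff map_matrix_def cross_matrix_def)
      then have "z = 0 \<or> z\<^sup>2 = (\<Sum>s\<in>UNIV. complex_of_real (p s) * complex_of_real (q s))"
        using cross_matrix_eigenvalue_cases [of "\<lambda>s. complex_of_real (p s)" k
            "\<lambda>s. complex_of_real (q s)" z] that pk qk by simp
      also have "(\<Sum>s\<in>UNIV. complex_of_real (p s) * complex_of_real (q s)) = (complex_of_real c)\<^sup>2"
        unfolding of_real_mult [symmetric] of_real_sum [symmetric] pq by simp
      finally show ?thesis
        by (auto simp: power2_eq_iff)
    qed
    then have "{z. is_eigenvalue (map_matrix complex_of_real (symbol A \<xi>)) z}
        = complex_of_real ` {- c, 0, c}"
      using eig by (auto intro: is_eigenvalue_complexification
          dest: is_eigenvalue_complexification simp del: of_real_minus of_real_0)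
    then have spec: "{z. is_eigenvalue (map_matrix complex_of_real (symbol A \<xi>)) z}
        = (\<lambda>i. complex_of_real (lam i \<xi>)) ` {1..3}"
      unfolding idx by (simp add: lam \<sigma>_def)
    have "lam i \<xi> \<in> {- c, 0, c}" for i
      by (simp add: lam \<sigma>_def)
    moreover have "\<forall>i\<in>{1..3}. \<forall>j\<in>{1..3}. i < j \<longrightarrow> lam i \<xi> < lam j \<xi>"
      using \<open>c > 0\<close> by (simp add: idx lam \<sigma>_def)
    ultimately show ?thesis
      using det spec semi by blast
  qed
  have hyp: "constantly_hyperbolic_with A 3 l lam"
    unfolding constantly_hyperbolic_with_def using analytic suml sphere by simp
  moreover have "lam 1 = (\<lambda>\<xi>. - c * norm \<xi>)" "lam 2 = (\<lambda>\<xi>. 0)" "lam 3 = (\<lambda>\<xi>. c * norm \<xi>)"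
    by (simp_all add: lam_def \<sigma>_def)
  moreover have "l 1 = 1" "l 2 = CARD('k) * CARD('d) + CARD('d) - 1" "l 3 = 1"
    by (simp_all add: l_def)
  ultimately show ?thesis
    unfolding constantly_hyperbolic_def by blast
qed

end
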